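(* Suppose that for all integers $1\le t<k$ and all $g\in\mathcal G_t^\star$ one has $f(x|k,g,\phi_k)=f(x|t,g,\phi_t)$, and that for all $1\le t<k$ the ratio $f(g|k,\alpha_k)/f(g|t,\alpha_t)$ takes one and the same value $a_{kt}$ for all $g\in\mathcal G_t^\star$; put $a_{kk}=1$. Then for every $k\ge 1$ $$f_k=\sum_{t=1}^{k}a_{kt}f_t^\star .$$ Moreover, for every $k\ge 2$, $$f_k=a_{k,k-1}f_{k-1}+f_k^\star .$$
   Context: Fix $n\ge1$ and data $x=(x_1,\dots,x_n)$. For each integer $k\ge1$ consider a mixture model with $k$ components. Its $j$th component ($1\le j\le k$) has density $p_{jk}(\cdot|\theta_{jk})$, the parameter $\theta_{jk}$ has prior probability density $\pi_{jk}(\cdot|\phi_{jk})$ with fixed hyperparameter $\phi_{jk}$, parameters being independent over $j$; the weights have a Dirichlet prior with hyperparameters $\alpha_{jk}>0$. Write $\phi_k=(\phi_{1k},\dots,\phi_{kk})$, $\alpha_k=(\alpha_{1k},\dots,\alpha_{kk})$, $\alpha_{0k}=\sum_{j=1}^k\alpha_{jk}$. Let $\mathcal G_k=\{1,\dots,k\}^n$ be the set of membership vectors $g=(g_1,\dots,g_n)$, so that $\mathcal G_t\subset\mathcal G_k$ for $t<k$. For $g\in\mathcal G_k$ let $A_j=\{i:g_i=j\}$, $n_j=\operatorname{card}(A_j)$, $x^j=\{x_i:i\in A_j\}$. After integrating out weights and component parameters, $$f(g|k,\alpha_k)=\frac{\Gamma(\alpha_{0k})}{\Gamma(\alpha_{0k}+n)}\prod_{j=1}^k\frac{\Gamma(\alpha_{jk}+n_j)}{\Gamma(\alpha_{jk})},\qquad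 f(x|k,g,\phi_k)=\prod_{j=1}^k q_{jk}(x^j|\phi_{jk}),$$ $$q_{jk}(x^j|\phi_{jk})=\int\prod_{i\in A_j}p_{jk}(x_i|\theta)\,\pi_{jk}(\theta|\phi_{jk})\,d\theta,$$ which are assumed finite (and $q_{jk}=1$ when $A_j=\varnothing$). The marginal likelihood is $f_k=\sum_{g\in\mathcal G_k}f(x|k,g,\phi_k)f(g|k,\alpha_k)$. Standing assumptions: for all $k\ge2$ and $1\le j\le k-1$, $\alpha_{jk}=\alpha_{jj}$, $p_{jk}(\cdot|\cdot)=p_{jj}(\cdot|\cdot)$, $\pi_{jk}(\cdot|\cdot)=\pi_{jj}(\cdot|\cdot)$, $\phi_{jk}=\phi_{jj}$. Let $\mathcal G_t^\star=\{g\in\mathcal G_t:\exists\, i\text{ with }g_i=t\}$ and $f_t^\star=\sum_{g\in\mathcal G_t^\star}f(x|t,g,\phi_t)f(g|t,\alpha_t)$. *)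

theory Defs
  imports "HOL-Analysis.Analysis"
begin

text \<open>
  Families indexed by (component, number of components) take the component index first:
  \<open>p j k\<close> is $p_{jk}$. The measure \<open>\<nu> j k\<close> is the reference measure written $d\theta$ on the
  parameter space of component \<open>j\<close>, whose underlying set is \<open>space (\<nu> j k)\<close>, so parameter spaces
  may differ between components (Lebesgue measures on spaces of different dimension, say)
  although all of them live in one type.
\<close>

definition prob_density :: "'a measure \<Rightarrow> ('a \<Rightarrow> real) \<Rightarrow> bool" where
  "prob_density M f \<longleftrightarrow>
     f \<in> borel_measurable M \<and> (\<forall>y\<in>space M. 0 \<le> f y) \<and> (\<integral>\<^sup>+ y. ennreal (f y) \<partial>M) = 1"

text \<open>
  The extensional function space makes a membership vector depend only on its \<open>n\<close> entries, so the
  sets below are finite and \<open>memberships n t \<subseteq> memberships n k\<close> for \<open>t \<le> k\<close>.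
\<close>

definition memberships :: "nat \<Rightarrow> nat \<Rightarrow> (nat \<Rightarrow> nat) set" where
  "memberships n k = {1..n} \<rightarrow>\<^sub>E {1..k}"

definition memberships_star :: "nat \<Rightarrow> nat \<Rightarrow> (nat \<Rightarrow> nat) set" where
  "memberships_star n t = {g \<in> memberships n t. \<exists>i\<in>{1..n}. g i = t}"

definition block :: "nat \<Rightarrow> (nat \<Rightarrow> nat) \<Rightarrow> nat \<Rightarrow> nat set" where
  "block n g j = {i \<in> {1..n}. g i = j}"

definition alpha_total :: "(nat \<Rightarrow> nat \<Rightarrow> real) \<Rightarrow> nat \<Rightarrow> real" where
  "alpha_total \<alpha> k = (\<Sum>j=1..k. \<alpha> j k)"

text \<open>$f(g \mid k, \alpha_k)$\<close>

definition alloc_prob :: "nat \<Rightarrow> (nat \<Rightarrow> nat \<Rightarrow> real) \<Rightarrow> nat \<Rightarrow> (nat \<Rightarrow> nat) \<Rightarrow> real" where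
  "alloc_prob n \<alpha> k g =
     Gamma (alpha_total \<alpha> k) / Gamma (alpha_total \<alpha> k + real n) *
     (\<Prod>j=1..k. Gamma (\<alpha> j k + real (card (block n g j))) / Gamma (\<alpha> j k))"

text \<open>
  $q_{jk}(x^j \mid \phi_{jk})$ for the observations with index set \<open>A\<close>. For empty \<open>A\<close> this is the
  integral of the prior density, that is 1.
\<close>

definition comp_marginal ::
  "(nat \<Rightarrow> nat \<Rightarrow> 'th measure) \<Rightarrow> (nat \<Rightarrow> nat \<Rightarrow> 'x \<Rightarrow> 'th \<Rightarrow> real) \<Rightarrow>
   (nat \<Rightarrow> nat \<Rightarrow> 'th \<Rightarrow> 'h \<Rightarrow> real) \<Rightarrow> (nat \<Rightarrow> nat \<Rightarrow> 'h) \<Rightarrow>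
   (nat \<Rightarrow> 'x) \<Rightarrow> nat \<Rightarrow> nat \<Rightarrow> nat set \<Rightarrow> real" where
  "comp_marginal \<nu> p \<pi> \<phi> x j k A =
     (\<integral>\<theta>. (\<Prod>i\<in>A. p j k (x i) \<theta>) * \<pi> j k \<theta> (\<phi> j k) \<partial>(\<nu> j k))"

text \<open>$f(x \mid k, g, \phi_k)$\<close>

definition data_lik ::
  "nat \<Rightarrow> (nat \<Rightarrow> nat \<Rightarrow> 'th measure) \<Rightarrow> (nat \<Rightarrow> nat \<Rightarrow> 'x \<Rightarrow> 'th \<Rightarrow> real) \<Rightarrow>
   (nat \<Rightarrow> nat \<Rightarrow> 'th \<Rightarrow> 'h \<Rightarrow> real) \<Rightarrow> (nat \<Rightarrow> nat \<Rightarrow> 'h) \<Rightarrow>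
   (nat \<Rightarrow> 'x) \<Rightarrow> nat \<Rightarrow> (nat \<Rightarrow> nat) \<Rightarrow> real" where
  "data_lik n \<nu> p \<pi> \<phi> x k g = (\<Prod>j=1..k. comp_marginal \<nu> p \<pi> \<phi> x j k (block n g j))"

text \<open>$f_k$ and $f_t^\star$\<close>

definition marg_lik ::
  "nat \<Rightarrow> (nat \<Rightarrow> nat \<Rightarrow> 'th measure) \<Rightarrow> (nat \<Rightarrow> nat \<Rightarrow> 'x \<Rightarrow> 'th \<Rightarrow> real) \<Rightarrow>
   (nat \<Rightarrow> nat \<Rightarrow> 'th \<Rightarrow> 'h \<Rightarrow> real) \<Rightarrow> (nat \<Rightarrow> nat \<Rightarrow> 'h) \<Rightarrow> (nat \<Rightarrow> nat \<Rightarrow> real) \<Rightarrow>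
   (nat \<Rightarrow> 'x) \<Rightarrow> nat \<Rightarrow> real" where
  "marg_lik n \<nu> p \<pi> \<phi> \<alpha> x k =
     (\<Sum>g\<in>memberships n k. data_lik n \<nu> p \<pi> \<phi> x k g * alloc_prob n \<alpha> k g)"

definition marg_lik_star ::
  "nat \<Rightarrow> (nat \<Rightarrow> nat \<Rightarrow> 'th measure) \<Rightarrow> (nat \<Rightarrow> nat \<Rightarrow> 'x \<Rightarrow> 'th \<Rightarrow> real) \<Rightarrow>
   (nat \<Rightarrow> nat \<Rightarrow> 'th \<Rightarrow> 'h \<Rightarrow> real) \<Rightarrow> (nat \<Rightarrow> nat \<Rightarrow> 'h) \<Rightarrow> (nat \<Rightarrow> nat \<Rightarrow> real) \<Rightarrow>
   (nat \<Rightarrow> 'x) \<Rightarrow> nat \<Rightarrow> real" where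
  "marg_lik_star n \<nu> p \<pi> \<phi> \<alpha> x t =
     (\<Sum>g\<in>memberships_star n t. data_lik n \<nu> p \<pi> \<phi> x t g * alloc_prob n \<alpha> t g)"

end

theory Submission
  imports Defs
begin

text \<open>
  Every membership vector has a largest label, so the vectors with labels in \<open>{1..k}\<close> split into
  the disjoint classes of vectors whose largest label is \<open>t\<close>, for \<open>t = 1, \<dots>, k\<close>
  (\<open>sum_memberships_by_max\<close>); these classes are the starred sets. On the class of \<open>t\<close> the two
  hypotheses turn each summand of \<open>f_k\<close> into \<open>a_kt\<close> times the corresponding summand of \<open>f_t\<close>,
  the division in the ratio being harmless as allocation probabilities are positive. Summing over
  each class, and then over the classes, gives the first formula.

  The recursion asks for more, namely the cocycle identity
  \<open>a_kt = a_(k,k-1) a_(k-1,t)\<close> for \<open>t < k\<close>. An empty component contributes the factor 1 to the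
  allocation probability, and the components present in both models have equal \<open>\<alpha>\<close>. Therefore
  \<open>a_kt = C_k / C_t\<close> with \<open>C_k = \<Gamma>(\<alpha>_0k) / \<Gamma>(\<alpha>_0k + n)\<close>
  (\<open>alloc_prob_more_components\<close>), and the quotients telescope. Since \<open>a\<close> is tied to the
  allocation probabilities only through members of the classes, it matters here that each class is
  inhabited, which is the case because there is at least one observation.
\<close>

lemma in_memberships_iff:
  "g \<in> memberships n k \<longleftrightarrow> g \<in> extensional {1..n} \<and> (\<forall>i\<in>{1..n}. 1 \<le> g i \<and> g i \<le> k)"
  unfolding memberships_def PiE_iff by (simp only: atLeastAtMost_iff) blast

lemma finite_memberships: "finite (memberships n k)"
  unfolding memberships_def by (intro finite_PiE) auto

lemma finite_memberships_star: "finite (memberships_star n t)"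
  by (rule finite_subset[OF _ finite_memberships[of n t]]) (auto simp: memberships_star_def)

lemma memberships_star_nonempty:
  assumes "1 \<le> n" "1 \<le> t"
  shows "memberships_star n t \<noteq> {}"
proof -
  have "(\<lambda>i\<in>{1..n}. t) \<in> memberships_star n t"
    using assms by (auto simp: memberships_star_def memberships_def)
  then show ?thesis by blast
qed

lemma memberships_eq_UN_star:
  assumes "1 \<le> n"
  shows "memberships n k = (\<Union>t\<in>{1..k}. memberships_star n t)"
proof (intro set_eqI iffI)
  fix g assume g: "g \<in> memberships n k"
  \<comment> \<open>The class of \<open>g\<close> is its largest label, which exists as there is an observation.\<close>
  define t where "t = Max (g ` {1..n})"
  have "t \<in> g ` {1..n}"
    unfolding t_def using assms by (intro Max_in) auto
  then obtain i where i: "i \<in> {1..n}" "g i = t" by auto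
  have le: "g l \<le> t" if "l \<in> {1..n}" for l
    unfolding t_def using that by (intro Max_ge) auto
  have "g \<in> memberships n t"
    using g le unfolding in_memberships_iff by blast
  with i have "g \<in> memberships_star n t" by (auto simp: memberships_star_def)
  moreover have "t \<in> {1..k}"
    using g i unfolding in_memberships_iff by force
  ultimately show "g \<in> (\<Union>t\<in>{1..k}. memberships_star n t)" by blast
next
  fix g assume "g \<in> (\<Union>t\<in>{1..k}. memberships_star n t)"
  then obtain t where "t \<le> k" "g \<in> memberships n t"
    by (auto simp: memberships_star_def)
  then show "g \<in> memberships n k"
    unfolding in_memberships_iff by (blast intro: order_trans)
qed

lemma memberships_star_disjoint:
  assumes "s \<noteq> t"
  shows "memberships_star n s \<inter> memberships_star n t = {}"
proof -
  have "s = t" if "g \<in> memberships_star n s" "g \<in> memberships_star n t" for g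
    using that unfolding memberships_star_def in_memberships_iff by (auto intro: order_antisym)
  with assms show ?thesis by blast
qed

lemma sum_memberships_by_max:
  fixes h :: "(nat \<Rightarrow> nat) \<Rightarrow> real"
  assumes "1 \<le> n"
  shows "(\<Sum>g\<in>memberships n k. h g) = (\<Sum>t=1..k. \<Sum>g\<in>memberships_star n t. h g)"
  unfolding memberships_eq_UN_star[OF assms]
  by (rule sum.UNION_disjoint) (auto simp: finite_memberships_star memberships_star_disjoint)

definition dirichlet_const :: "nat \<Rightarrow> (nat \<Rightarrow> nat \<Rightarrow> real) \<Rightarrow> nat \<Rightarrow> real" where
  "dirichlet_const n \<alpha> k = Gamma (alpha_total \<alpha> k) / Gamma (alpha_total \<alpha> k + real n)"

lemma dirichlet_const_pos:
  assumes "1 \<le> k" "\<forall>j\<in>{1..k}. 0 < \<alpha> j k"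
  shows "0 < dirichlet_const n \<alpha> k"
proof -
  have "0 < alpha_total \<alpha> k"
    unfolding alpha_total_def using assms by (intro sum_pos) auto
  then show ?thesis
    unfolding dirichlet_const_def by (intro divide_pos_pos Gamma_real_pos) auto
qed

lemma alloc_prob_pos:
  assumes "1 \<le> k" "\<forall>j\<in>{1..k}. 0 < \<alpha> j k"
  shows "0 < alloc_prob n \<alpha> k g"
proof -
  have "0 < (\<Prod>j=1..k. Gamma (\<alpha> j k + real (card (block n g j))) / Gamma (\<alpha> j k))"
    using assms(2) by (intro prod_pos ballI divide_pos_pos Gamma_real_pos) (auto intro: add_pos_nonneg)
  then show ?thesis
    unfolding alloc_prob_def dirichlet_const_def[symmetric]
    using dirichlet_const_pos[of k \<alpha> n, OF assms] by (rule mult_pos_pos[rotated])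
qed

text \<open>
  For a vector that uses only the labels up to \<open>t\<close>, the components \<open>t + 1, \<dots>, k\<close> are empty, and
  the factor of an empty component is \<open>\<Gamma>(\<alpha>) / \<Gamma>(\<alpha>) = 1\<close>. Going from \<open>t\<close> to \<open>k\<close> components thus
  changes the normalising constant alone, in a way that does not depend on the vector.
\<close>

lemma alloc_prob_more_components:
  assumes "t \<le> k" "1 \<le> t"
    and g: "g \<in> memberships n t"
    and pos_k: "\<forall>j\<in>{1..k}. 0 < \<alpha> j k"
    and pos_t: "\<forall>j\<in>{1..t}. 0 < \<alpha> j t"
    and same: "\<forall>j\<in>{1..t}. \<alpha> j k = \<alpha> j t"
  shows "alloc_prob n \<alpha> k g / alloc_prob n \<alpha> t g = dirichlet_const n \<alpha> k / dirichlet_const n \<alpha> t"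
proof -
  let ?P = "\<lambda>m. \<Prod>j=1..m. Gamma (\<alpha> j m + real (card (block n g j))) / Gamma (\<alpha> j m)"
  have "(\<Prod>j=1..k. Gamma (\<alpha> j k + real (card (block n g j))) / Gamma (\<alpha> j k))
      = (\<Prod>j=1..t. Gamma (\<alpha> j k + real (card (block n g j))) / Gamma (\<alpha> j k))"
  proof (rule prod.mono_neutral_right)
    show "\<forall>j\<in>{1..k} - {1..t}. Gamma (\<alpha> j k + real (card (block n g j))) / Gamma (\<alpha> j k) = 1"
    proof
      fix j assume j: "j \<in> {1..k} - {1..t}"
      then have "block n g j = {}"
        using g unfolding block_def in_memberships_iff by force
      moreover have "0 < Gamma (\<alpha> j k)"
        using pos_k j by (intro Gamma_real_pos) auto
      ultimately show "Gamma (\<alpha> j k + real (card (block n g j))) / Gamma (\<alpha> j k) = 1"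
        by simp
    qed
  qed (use \<open>t \<le> k\<close> in auto)
  also have "\<dots> = ?P t"
    using same by (intro prod.cong) auto
  finally have P: "?P k = ?P t" .
  have split: "alloc_prob n \<alpha> m g = dirichlet_const n \<alpha> m * ?P m" for m
    by (simp add: alloc_prob_def dirichlet_const_def)
  have "?P t \<noteq> 0"
    using alloc_prob_pos[of t \<alpha> n g, OF \<open>1 \<le> t\<close> pos_t] unfolding split
    by (metis less_irrefl mult_zero_right)
  then show ?thesis
    unfolding split P by simp
qed

theorem theorem3p1:
  fixes n :: nat
    and x :: "nat \<Rightarrow> 'x"
    and \<mu> :: "'x measure"
    and \<nu> :: "nat \<Rightarrow> nat \<Rightarrow> 'th measure"
    and p :: "nat \<Rightarrow> nat \<Rightarrow> 'x \<Rightarrow> 'th \<Rightarrow> real"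
    and \<pi> :: "nat \<Rightarrow> nat \<Rightarrow> 'th \<Rightarrow> 'h \<Rightarrow> real"
    and \<phi> :: "nat \<Rightarrow> nat \<Rightarrow> 'h"
    and \<alpha> a :: "nat \<Rightarrow> nat \<Rightarrow> real"
  assumes n_pos: "1 \<le> n"
    and data: "\<forall>i\<in>{1..n}. x i \<in> space \<mu>"
    and component_density:
      "\<forall>k\<ge>1. \<forall>j\<in>{1..k}. \<forall>\<theta>\<in>space (\<nu> j k). prob_density \<mu> (\<lambda>y. p j k y \<theta>)"
    and prior_density:
      "\<forall>k\<ge>1. \<forall>j\<in>{1..k}. prob_density (\<nu> j k) (\<lambda>\<theta>. \<pi> j k \<theta> (\<phi> j k))"
    and alpha_pos: "\<forall>k\<ge>1. \<forall>j\<in>{1..k}. 0 < \<alpha> j k"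
    and finite_marginals:
      "\<forall>k\<ge>1. \<forall>g\<in>memberships n k. \<forall>j\<in>{1..k}.
         integrable (\<nu> j k) (\<lambda>\<theta>. (\<Prod>i\<in>block n g j. p j k (x i) \<theta>) * \<pi> j k \<theta> (\<phi> j k))"
    and standing:
      "\<forall>k\<ge>2. \<forall>j\<in>{1..k - 1}.
         \<alpha> j k = \<alpha> j j \<and> \<nu> j k = \<nu> j j \<and> p j k = p j j \<and> \<pi> j k = \<pi> j j \<and> \<phi> j k = \<phi> j j"
    and lik_eq:
      "\<forall>k t. 1 \<le> t \<and> t < k \<longrightarrow>
         (\<forall>g\<in>memberships_star n t. data_lik n \<nu> p \<pi> \<phi> x k g = data_lik n \<nu> p \<pi> \<phi> x t g)"
    and ratio:
      "\<forall>k t. 1 \<le> t \<and> t < k \<longrightarrow>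
         (\<forall>g\<in>memberships_star n t. alloc_prob n \<alpha> k g / alloc_prob n \<alpha> t g = a k t)"
    and a_diag: "\<forall>k\<ge>1. a k k = 1"
  shows "(\<forall>k\<ge>1. marg_lik n \<nu> p \<pi> \<phi> \<alpha> x k = (\<Sum>t=1..k. a k t * marg_lik_star n \<nu> p \<pi> \<phi> \<alpha> x t)) \<and>
         (\<forall>k\<ge>2. marg_lik n \<nu> p \<pi> \<phi> \<alpha> x k =
            a k (k - 1) * marg_lik n \<nu> p \<pi> \<phi> \<alpha> x (k - 1) + marg_lik_star n \<nu> p \<pi> \<phi> \<alpha> x k)"
proof -
  define f where "f = marg_lik n \<nu> p \<pi> \<phi> \<alpha> x"
  define fs where "fs = marg_lik_star n \<nu> p \<pi> \<phi> \<alpha> x"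
  define C where "C = dirichlet_const n \<alpha>"
  have C_pos: "0 < C k" if "1 \<le> k" for k
    unfolding C_def using that alpha_pos by (intro dirichlet_const_pos) auto
  have class_sum:
    "(\<Sum>g\<in>memberships_star n t. data_lik n \<nu> p \<pi> \<phi> x k g * alloc_prob n \<alpha> k g) = a k t * fs t"
    if t: "t \<in> {1..k}" for k t
  proof (cases "t = k")
    case True
    then show ?thesis
      using t a_diag by (simp add: fs_def marg_lik_star_def)
  next
    case False
    with t have lt: "1 \<le> t \<and> t < k" by auto
    have "data_lik n \<nu> p \<pi> \<phi> x k g * alloc_prob n \<alpha> k g
        = a k t * (data_lik n \<nu> p \<pi> \<phi> x t g * alloc_prob n \<alpha> t g)"
      if g: "g \<in> memberships_star n t" for g
    proof -
      have "0 < alloc_prob n \<alpha> t g"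
        using lt alpha_pos by (intro alloc_prob_pos) auto
      moreover have "alloc_prob n \<alpha> k g / alloc_prob n \<alpha> t g = a k t"
        using ratio lt g by blast
      ultimately have "alloc_prob n \<alpha> k g = a k t * alloc_prob n \<alpha> t g"
        by (simp add: field_simps)
      moreover have "data_lik n \<nu> p \<pi> \<phi> x k g = data_lik n \<nu> p \<pi> \<phi> x t g"
        using lik_eq lt g by blast
      ultimately show ?thesis by simp
    qed
    then show ?thesis
      by (simp add: fs_def marg_lik_star_def sum_distrib_left)
  qed
  have decomposition: "f k = (\<Sum>t=1..k. a k t * fs t)" for k
    unfolding f_def marg_lik_def sum_memberships_by_max[OF n_pos]
    by (intro sum.cong refl class_sum)
  have a_eq: "a k t = C k / C t" if t: "t \<in> {1..k}" for k t
  proof (cases "t = k")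
    case True
    then show ?thesis
      using t a_diag C_pos[of k] by simp
  next
    case False
    with t have lt: "1 \<le> t \<and> t < k" by auto
    \<comment> \<open>The standing assumption compares each model with the \<open>j\<close>-component one, in which \<open>j\<close> is the
      last label; the case \<open>j = t\<close> lies outside its range for the \<open>t\<close>-component model but is trivial.\<close>
    have last: "\<alpha> j m = \<alpha> j j" if "2 \<le> m" "j \<in> {1..m - 1}" for j m
      using standing that by blast
    have same: "\<alpha> j k = \<alpha> j t" if j: "j \<in> {1..t}" for j
    proof -
      have "\<alpha> j k = \<alpha> j j"
        using j lt by (intro last) auto
      moreover have "\<alpha> j t = \<alpha> j j"
      proof (cases "j = t")
        case False
        then show ?thesis using j by (intro last) auto
      qed simp
      ultimately show ?thesis by simp
    qed
    obtain g where g: "g \<in> memberships_star n t"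
      using memberships_star_nonempty[OF n_pos] lt by blast
    then have "g \<in> memberships n t" by (simp add: memberships_star_def)
    then have "alloc_prob n \<alpha> k g / alloc_prob n \<alpha> t g = C k / C t"
      unfolding C_def using lt alpha_pos same by (intro alloc_prob_more_components) auto
    moreover have "alloc_prob n \<alpha> k g / alloc_prob n \<alpha> t g = a k t"
      using ratio lt g by blast
    ultimately show ?thesis by simp
  qed
  have recursion: "f k = a k (k - 1) * f (k - 1) + fs k" if k: "2 \<le> k" for k
  proof -
    obtain m where m: "k = Suc m" "1 \<le> m"
      using k by (cases k) auto
    have cocycle: "a k t = a k m * a m t" if "t \<in> {1..m}" for t
      using that m a_eq[of t k] a_eq[of m k] a_eq[of t m] C_pos[of m] by simp
    have "f k = (\<Sum>t=1..m. a k t * fs t) + a k k * fs k"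
      unfolding decomposition m(1) by simp
    also have "(\<Sum>t=1..m. a k t * fs t) = a k m * f m"
      unfolding decomposition[of m] sum_distrib_left
      by (intro sum.cong refl) (metis cocycle mult.assoc)
    finally show ?thesis
      using a_diag m by simp
  qed
  show ?thesis
    using decomposition recursion unfolding f_def fs_def by blast
qed

end
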